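(* The simplicial group $\mathrm{VAP}_*$ with $\mathrm{VAP}_n=VP_{n+1}$, $n\ge 0$, is contractible.
   Context: The virtual pure braid group $VP_n$ ($n\ge 2$) is the group with generators $\lambda_{ij}$, $1\le i\neq j\le n$, and relations $\lambda_{ij}\lambda_{kl}=\lambda_{kl}\lambda_{ij}$ and $\lambda_{ki}\lambda_{kj}\lambda_{ij}=\lambda_{ij}\lambda_{kj}\lambda_{ki}$, where distinct letters stand for distinct indices; $VP_1$ is trivial. The simplicial group $\mathrm{VAP}_*$ has $\mathrm{VAP}_n=VP_{n+1}$. The face $d_{i}\colon VP_{n+1}\to VP_{n}$, $0\le i\le n$, deletes the $(i+1)$-th strand: it sends $\lambda_{kl}$ to $1$ if $i+1\in\{k,l\}$, and otherwise to $\lambda_{k'l'}$, where $m'=m$ if $m<i+1$ and $m'=m-1$ if $m>i+1$. The degeneracy $s_{i}\colon VP_{n+1}\to VP_{n+2}$, $0\le i\le n$, doubles the $(i+1)$-th strand; explicitly, for $k<l$ and $1\le i\le n+1$: $s_{i-1}(\lambda_{k,l})=\lambda_{k+1,l+1}$ if $i<k$; $\lambda_{k,l+1}\lambda_{k+1,l+1}$ if $i=k$; $\lambda_{k,l+1}$ if $k<i<l$; $\lambda_{k,l+1}\lambda_{k,l}$ if $i=l$; $\lambda_{k,l}$ if $i>l$; $s_{i-1}(\lambda_{l,k})=\lambda_{l+1,k+1}$ if $i<k$; $\lambda_{l+1,k+1}\lambda_{l+1,k}$ if $i=k$; $\lambda_{l+1,k}$ if $k<i<l$; $\lambda_{l,k}\lambda_{l+1,k}$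 if $i=l$; $\lambda_{l,k}$ if $i>l$. A simplicial group $G_*$ is contractible if all its Moore homotopy groups $\pi_n(G_* )=\bigcap_{i=0}^n\mathrm{Ker}(d_i\colon G_n\to G_{n-1})\big/d_0\left(\bigcap_{i=1}^{n+1}\mathrm{Ker}(d_i\colon G_{n+1}\to G_n)\right)$, $n\ge 0$, are trivial (with $G_{-1}=1$). *)

theory Defs
  imports "HOL-Algebra.Elementary_Groups"
begin

section \<open>Groups given by generators and relations\<close>

text \<open>A letter \<open>(x, True)\<close> stands for the generator \<open>x\<close>, and \<open>(x, False)\<close> for its formal inverse.\<close>

type_synonym 'a gword = "('a \<times> bool) list"

definition gwords :: "'a set \<Rightarrow> 'a gword set" where
  "gwords X = lists (X \<times> UNIV)"

definition positive_word :: "'a list \<Rightarrow> 'a gword" where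
  "positive_word xs = map (\<lambda>x. (x, True)) xs"

text \<open>The congruence on words over \<open>X\<close> whose classes are the elements of the group
  with generators \<open>X\<close> and relations \<open>u = v\<close> for \<open>(u, v) \<in> R\<close>.\<close>

inductive_set presented_cong :: "'a set \<Rightarrow> ('a gword \<times> 'a gword) set \<Rightarrow> ('a gword \<times> 'a gword) set"
  for X :: "'a set" and R :: "('a gword \<times> 'a gword) set"
where
  refl: "w \<in> gwords X \<Longrightarrow> (w, w) \<in> presented_cong X R"
| sym: "(v, w) \<in> presented_cong X R \<Longrightarrow> (w, v) \<in> presented_cong X R"
| trans: "(u, v) \<in> presented_cong X R \<Longrightarrow> (v, w) \<in> presented_cong X R \<Longrightarrow> (u, w) \<in> presented_cong X R"
| cancel: "u \<in> gwords X \<Longrightarrow> v \<in> gwords X \<Longrightarrow> x \<in> X \<Longrightarrow>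
    (u @ [(x, b), (x, \<not> b)] @ v, u @ v) \<in> presented_cong X R"
| relation: "u \<in> gwords X \<Longrightarrow> v \<in> gwords X \<Longrightarrow> (r, s) \<in> R \<Longrightarrow> r \<in> gwords X \<Longrightarrow> s \<in> gwords X \<Longrightarrow>
    (u @ r @ v, u @ s @ v) \<in> presented_cong X R"

definition presented_group :: "'a set \<Rightarrow> ('a gword \<times> 'a gword) set \<Rightarrow> 'a gword set monoid" where
  "presented_group X R =
     \<lparr> carrier = gwords X // presented_cong X R,
       mult = (\<lambda>A B. \<Union>a\<in>A. \<Union>b\<in>B. presented_cong X R `` {a @ b}),
       one = presented_cong X R `` {[]} \<rparr>"

definition presented_gen :: "'a set \<Rightarrow> ('a gword \<times> 'a gword) set \<Rightarrow> 'a \<Rightarrow> 'a gword set" where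
  "presented_gen X R x = presented_cong X R `` {[(x, True)]}"

primrec eval_gword :: "('b, 'm) monoid_scheme \<Rightarrow> ('a \<Rightarrow> 'b) \<Rightarrow> 'a gword \<Rightarrow> 'b" where
  "eval_gword H f [] = \<one>\<^bsub>H\<^esub>"
| "eval_gword H f (a # w) =
     (if snd a then f (fst a) else inv\<^bsub>H\<^esub> (f (fst a))) \<otimes>\<^bsub>H\<^esub> eval_gword H f w"

text \<open>The homomorphism from a presented group to \<open>H\<close> that sends each generator \<open>x\<close> to \<open>f x\<close>.
  It is meaningful only if \<open>f\<close> respects the relations, so that every class of words has
  exactly one value in \<open>H\<close>.\<close>

definition presented_hom :: "('b, 'm) monoid_scheme \<Rightarrow> ('a \<Rightarrow> 'b) \<Rightarrow> 'a gword set \<Rightarrow> 'b" where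
  "presented_hom H f C = the_elem (eval_gword H f ` C)"


section \<open>Simplicial groups and their Moore homotopy groups\<close>

text \<open>\<open>d n i\<close> is the face \<open>d\<^sub>i : G\<^sub>n \<rightarrow> G\<^sub>n\<^sub>-\<^sub>1\<close> (used only for \<open>n \<ge> 1\<close>, \<open>i \<le> n\<close>), and
  \<open>s n i\<close> is the degeneracy \<open>s\<^sub>i : G\<^sub>n \<rightarrow> G\<^sub>n\<^sub>+\<^sub>1\<close> (used only for \<open>i \<le> n\<close>).\<close>

locale simplicial_group =
  fixes G :: "nat \<Rightarrow> 'a monoid"
    and d :: "nat \<Rightarrow> nat \<Rightarrow> 'a \<Rightarrow> 'a"
    and s :: "nat \<Rightarrow> nat \<Rightarrow> 'a \<Rightarrow> 'a"
  assumes group: "group (G n)"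
    and face_hom: "i \<le> Suc n \<Longrightarrow> d (Suc n) i \<in> hom (G (Suc n)) (G n)"
    and degen_hom: "i \<le> n \<Longrightarrow> s n i \<in> hom (G n) (G (Suc n))"
    and face_face: "\<lbrakk>i < j; j \<le> Suc (Suc n); x \<in> carrier (G (Suc (Suc n)))\<rbrakk> \<Longrightarrow>
      d (Suc n) i (d (Suc (Suc n)) j x) = d (Suc n) (j - 1) (d (Suc (Suc n)) i x)"
    and degen_degen: "\<lbrakk>i \<le> j; j \<le> n; x \<in> carrier (G n)\<rbrakk> \<Longrightarrow>
      s (Suc n) i (s n j x) = s (Suc n) (Suc j) (s n i x)"
    and face_degen_less: "\<lbrakk>i < j; j \<le> Suc n; x \<in> carrier (G (Suc n))\<rbrakk> \<Longrightarrow>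
      d (Suc (Suc n)) i (s (Suc n) j x) = s n (j - 1) (d (Suc n) i x)"
    and face_degen_same: "\<lbrakk>j \<le> n; i = j \<or> i = Suc j; x \<in> carrier (G n)\<rbrakk> \<Longrightarrow>
      d (Suc n) i (s n j x) = x"
    and face_degen_greater: "\<lbrakk>Suc j < i; i \<le> Suc (Suc n); x \<in> carrier (G (Suc n))\<rbrakk> \<Longrightarrow>
      d (Suc (Suc n)) i (s (Suc n) j x) = s n j (d (Suc n) (i - 1) x)"

text \<open>Since \<open>G\<^sub>-\<^sub>1 = 1\<close>, every element of \<open>G\<^sub>0\<close> is a cycle.\<close>

definition moore_cycles :: "(nat \<Rightarrow> 'a monoid) \<Rightarrow> (nat \<Rightarrow> nat \<Rightarrow> 'a \<Rightarrow> 'a) \<Rightarrow> nat \<Rightarrow> 'a set" where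
  "moore_cycles G d n =
     (if n = 0 then carrier (G 0) else (\<Inter>i\<in>{0..n}. kernel (G n) (G (n - 1)) (d n i)))"

definition moore_boundaries :: "(nat \<Rightarrow> 'a monoid) \<Rightarrow> (nat \<Rightarrow> nat \<Rightarrow> 'a \<Rightarrow> 'a) \<Rightarrow> nat \<Rightarrow> 'a set" where
  "moore_boundaries G d n =
     d (n + 1) 0 ` (\<Inter>i\<in>{1..n + 1}. kernel (G (n + 1)) (G n) (d (n + 1) i))"

definition moore_homotopy_group ::
    "(nat \<Rightarrow> 'a monoid) \<Rightarrow> (nat \<Rightarrow> nat \<Rightarrow> 'a \<Rightarrow> 'a) \<Rightarrow> nat \<Rightarrow> 'a set monoid" where
  "moore_homotopy_group G d n =
     ((G n)\<lparr>carrier := moore_cycles G d n\<rparr>) Mod (moore_boundaries G d n)"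

definition contractible_simplicial_group ::
    "(nat \<Rightarrow> 'a monoid) \<Rightarrow> (nat \<Rightarrow> nat \<Rightarrow> 'a \<Rightarrow> 'a) \<Rightarrow> (nat \<Rightarrow> nat \<Rightarrow> 'a \<Rightarrow> 'a) \<Rightarrow> bool" where
  "contractible_simplicial_group G d s \<longleftrightarrow>
     simplicial_group G d s \<and> (\<forall>n. trivial_group (moore_homotopy_group G d n))"


section \<open>Virtual pure braid groups\<close>

text \<open>The pair \<open>(i, j)\<close> is the generator \<open>\<lambda>\<^sub>i\<^sub>j\<close>; strands are numbered from \<open>1\<close>.
  For \<open>n = 1\<close> there are no generators, so \<open>VP 1\<close> is trivial.\<close>

definition VP_gens :: "nat \<Rightarrow> (nat \<times> nat) set" where
  "VP_gens n = {(i, j). i \<in> {1..n} \<and> j \<in> {1..n} \<and> i \<noteq> j}"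

definition VP_rels :: "nat \<Rightarrow> ((nat \<times> nat) gword \<times> (nat \<times> nat) gword) set" where
  "VP_rels n =
     {(positive_word [(i, j), (k, l)], positive_word [(k, l), (i, j)]) | i j k l.
        {i, j, k, l} \<subseteq> {1..n} \<and> distinct [i, j, k, l]} \<union>
     {(positive_word [(k, i), (k, j), (i, j)], positive_word [(i, j), (k, j), (k, i)]) | i j k.
        {i, j, k} \<subseteq> {1..n} \<and> distinct [i, j, k]}"

definition VP :: "nat \<Rightarrow> (nat \<times> nat) gword set monoid" where
  "VP n = presented_group (VP_gens n) (VP_rels n)"

definition VP_gen :: "nat \<Rightarrow> nat \<Rightarrow> nat \<Rightarrow> (nat \<times> nat) gword set" where
  "VP_gen n i j = presented_gen (VP_gens n) (VP_rels n) (i, j)"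


section \<open>The simplicial group VAP\<close>

definition VAP :: "nat \<Rightarrow> (nat \<times> nat) gword set monoid" where
  "VAP n = VP (n + 1)"

definition strand_shift :: "nat \<Rightarrow> nat \<Rightarrow> nat" where
  "strand_shift p m = (if m < p then m else m - 1)"

definition VAP_face :: "nat \<Rightarrow> nat \<Rightarrow> (nat \<times> nat) gword set \<Rightarrow> (nat \<times> nat) gword set" where
  "VAP_face n i = presented_hom (VP n)
     (\<lambda>(k, l). if i + 1 \<in> {k, l} then \<one>\<^bsub>VP n\<^esub>
               else VP_gen n (strand_shift (i + 1) k) (strand_shift (i + 1) l))"

text \<open>The images of \<open>\<lambda>\<^sub>k\<^sub>l\<close> and of \<open>\<lambda>\<^sub>l\<^sub>k\<close>, for \<open>k < l\<close>, when strand \<open>p\<close> is doubled;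
  \<open>N\<close> is the number of strands after doubling.\<close>

definition double_strand_kl :: "nat \<Rightarrow> nat \<Rightarrow> nat \<Rightarrow> nat \<Rightarrow> (nat \<times> nat) gword set" where
  "double_strand_kl N p k l =
     (if p < k then VP_gen N (k + 1) (l + 1)
      else if p = k then VP_gen N k (l + 1) \<otimes>\<^bsub>VP N\<^esub> VP_gen N (k + 1) (l + 1)
      else if p < l then VP_gen N k (l + 1)
      else if p = l then VP_gen N k (l + 1) \<otimes>\<^bsub>VP N\<^esub> VP_gen N k l
      else VP_gen N k l)"

definition double_strand_lk :: "nat \<Rightarrow> nat \<Rightarrow> nat \<Rightarrow> nat \<Rightarrow> (nat \<times> nat) gword set" where
  "double_strand_lk N p l k =
     (if p < k then VP_gen N (l + 1) (k + 1)
      else if p = k then VP_gen N (l + 1) (k + 1) \<otimes>\<^bsub>VP N\<^esub> VP_gen N (l + 1) k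
      else if p < l then VP_gen N (l + 1) k
      else if p = l then VP_gen N l k \<otimes>\<^bsub>VP N\<^esub> VP_gen N (l + 1) k
      else VP_gen N l k)"

definition VAP_degen :: "nat \<Rightarrow> nat \<Rightarrow> (nat \<times> nat) gword set \<Rightarrow> (nat \<times> nat) gword set" where
  "VAP_degen n i = presented_hom (VP (n + 2))
     (\<lambda>(a, b). if a < b then double_strand_kl (n + 2) (i + 1) a b
               else double_strand_lk (n + 2) (i + 1) a b)"

end

theory Submission
  imports Defs
begin

text \<open>
  Adding a trivial strand in front, \<open>\<lambda>\<^sub>k\<^sub>l \<mapsto> \<lambda>\<^sub>k\<^sub>+\<^sub>1\<^sub>,\<^sub>l\<^sub>+\<^sub>1\<close>, is a homomorphism
  \<open>h : VP\<^sub>n \<rightarrow> VP\<^sub>n\<^sub>+\<^sub>1\<close> because the defining relations do not depend on the names of the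
  strands. Deleting the new strand undoes it, and deleting an older strand commutes with it:
  \<open>d\<^sub>0 h = id\<close> and \<open>d\<^sub>i\<^sub>+\<^sub>1 h = h d\<^sub>i\<close>. So if all faces of \<open>z\<close> vanish, then all faces of
  \<open>h z\<close> other than \<open>d\<^sub>0\<close> vanish and \<open>z = d\<^sub>0 (h z)\<close> is a boundary. In degree \<open>0\<close> the equation
  \<open>d\<^sub>1 h = 1\<close> is automatic since \<open>VP\<^sub>1\<close> is trivial. This argument, for any simplicial group, is
  \<open>contractible_if_extra_degeneracy\<close>.

  The longer part is that \<open>VAP\<close> is a simplicial group at all. By the universal property
  (\<open>VP_hom_exists\<close>) a map on generators extends to a homomorphism once it respects the
  commutation relations and the triangle relations, and by \<open>VP_comp_eqI\<close> each simplicial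
  identity need only be checked on generators. For faces both are immediate: when the deleted
  strand occurs in a relation, the two sides become literally equal. For degeneracies, doubling
  strand \<open>p\<close> replaces a generator that involves \<open>p\<close> by the product of its two lifts, ordered by
  increasing first index or by decreasing second index; this is the order for which the doubled
  triangle relations (\<open>double_strand_triangle\<close>) follow from two undoubled ones and commutation of
  generators on disjoint pairs of strands. Among the simplicial identities only
  \<open>s\<^sub>i s\<^sub>j = s\<^sub>j\<^sub>+\<^sub>1 s\<^sub>i\<close> with \<open>i < j\<close>, evaluated on a generator joining the two doubled strands,
  uses a relation of the group; all others are identities of words.
\<close>

section \<open>The universal property of a presented group\<close>

abbreviation word_class :: "'a set \<Rightarrow> ('a gword \<times> 'a gword) set \<Rightarrow> 'a gword \<Rightarrow> 'a gword set" where
  "word_class X R w \<equiv> presented_cong X R `` {w}"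

lemma gwords_simps [simp]:
  "[] \<in> gwords X"
  "a # w \<in> gwords X \<longleftrightarrow> fst a \<in> X \<and> w \<in> gwords X"
  "u @ v \<in> gwords X \<longleftrightarrow> u \<in> gwords X \<and> v \<in> gwords X"
  by (auto simp: gwords_def mem_Times_iff)

lemma presented_cong_in_gwords:
  "(u, v) \<in> presented_cong X R \<Longrightarrow> u \<in> gwords X \<and> v \<in> gwords X"
  by (induction rule: presented_cong.induct) auto

lemma equiv_presented_cong: "equiv (gwords X) (presented_cong X R)"
  by (rule equivI)
    (auto simp: refl_on_def sym_def trans_def dest: presented_cong_in_gwords
      intro: presented_cong.intros(1,2) presented_cong.trans)

lemma presented_cong_append_left:
  assumes "(u, v) \<in> presented_cong X R" "w \<in> gwords X"
  shows "(w @ u, w @ v) \<in> presented_cong X R"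
  using assms
proof (induction rule: presented_cong.induct)
  case (cancel u v x b)
  then show ?case using presented_cong.cancel[where u = "w @ u" and v = v] by simp
next
  case (relation u v r s)
  then show ?case using presented_cong.relation[where u = "w @ u" and v = v] by simp
qed (auto intro: presented_cong.intros(1,2) presented_cong.trans)

lemma presented_cong_append_right:
  assumes "(u, v) \<in> presented_cong X R" "w \<in> gwords X"
  shows "(u @ w, v @ w) \<in> presented_cong X R"
  using assms
proof (induction rule: presented_cong.induct)
  case (cancel u v x b)
  then show ?case using presented_cong.cancel[where u = u and v = "v @ w"] by simp
next
  case (relation u v r s)
  then show ?case using presented_cong.relation[where u = u and v = "v @ w"] by simp
qed (auto intro: presented_cong.intros(1,2) presented_cong.trans)

lemma presented_cong_append:
  "(u, u') \<in> presented_cong X R \<Longrightarrow> (v, v') \<in> presented_cong X R \<Longrightarrow>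
    (u @ v, u' @ v') \<in> presented_cong X R"
  by (meson presented_cong.trans presented_cong_append_left presented_cong_append_right
      presented_cong_in_gwords)

lemma carrier_presented_group:
  "carrier (presented_group X R) = word_class X R ` gwords X"
  by (auto simp: presented_group_def quotient_def)

lemma word_class_closed: "w \<in> gwords X \<Longrightarrow> word_class X R w \<in> carrier (presented_group X R)"
  unfolding carrier_presented_group by (rule imageI)

lemma one_presented_group: "\<one>\<^bsub>presented_group X R\<^esub> = word_class X R []"
  by (simp add: presented_group_def)

lemma word_class_eq_iff:
  "u \<in> gwords X \<Longrightarrow> v \<in> gwords X \<Longrightarrow>
    word_class X R u = word_class X R v \<longleftrightarrow> (u, v) \<in> presented_cong X R"
  by (rule eq_equiv_class_iff[OF equiv_presented_cong])

lemma mult_word_class: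
  assumes "u \<in> gwords X" "v \<in> gwords X"
  shows "word_class X R u \<otimes>\<^bsub>presented_group X R\<^esub> word_class X R v = word_class X R (u @ v)"
proof -
  let ?U = "word_class X R u" and ?V = "word_class X R v"
  have rep: "word_class X R (a @ b) = word_class X R (u @ v)" if "a \<in> ?U" "b \<in> ?V" for a b
  proof -
    have "(u @ v, a @ b) \<in> presented_cong X R"
      using that by (auto intro: presented_cong_append)
    then show ?thesis
      by (metis equiv_class_eq equiv_presented_cong)
  qed
  have nonempty: "?U \<noteq> {}" "?V \<noteq> {}"
    using assms by (auto intro: presented_cong.refl)
  have "?U \<otimes>\<^bsub>presented_group X R\<^esub> ?V = (\<Union>a\<in>?U. \<Union>b\<in>?V. word_class X R (a @ b))"
    by (simp add: presented_group_def)
  also have "\<dots> = (\<Union>a\<in>?U. \<Union>b\<in>?V. word_class X R (u @ v))"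
    by (intro SUP_cong HOL.refl rep)
  also have "\<dots> = word_class X R (u @ v)"
    using nonempty by (simp only: UN_constant if_False)
  finally show ?thesis .
qed

definition inverse_word :: "'a gword \<Rightarrow> 'a gword" where
  "inverse_word w = map (\<lambda>(x, b). (x, \<not> b)) (rev w)"

lemma inverse_word_in_gwords: "w \<in> gwords X \<Longrightarrow> inverse_word w \<in> gwords X"
  by (induction w) (auto simp: inverse_word_def split: prod.splits)

lemma inverse_word_cancel:
  "w \<in> gwords X \<Longrightarrow> (inverse_word w @ w, []) \<in> presented_cong X R"
proof (induction w)
  case Nil
  then show ?case by (simp add: inverse_word_def presented_cong.refl)
next
  case (Cons a w)
  obtain x b where a: "a = (x, b)" by (cases a)
  have "(inverse_word w @ [(x, \<not> b), (x, \<not> \<not> b)] @ w, inverse_word w @ w) \<in> presented_cong X R"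
    using Cons.prems a by (intro presented_cong.cancel) (auto intro: inverse_word_in_gwords)
  moreover have "inverse_word (a # w) @ a # w = inverse_word w @ [(x, \<not> b), (x, \<not> \<not> b)] @ w"
    by (simp add: inverse_word_def a)
  ultimately show ?case
    using Cons by (auto intro: presented_cong.trans)
qed

lemma group_presented_group: "group (presented_group X R)"
proof (rule groupI)
  fix x
  assume "x \<in> carrier (presented_group X R)"
  then obtain w where w: "w \<in> gwords X" "x = word_class X R w"
    by (auto simp: carrier_presented_group)
  then have "word_class X R (inverse_word w) \<otimes>\<^bsub>presented_group X R\<^esub> x = \<one>\<^bsub>presented_group X R\<^esub>"
    by (simp add: mult_word_class inverse_word_in_gwords one_presented_group word_class_eq_iff
        inverse_word_cancel)
  then show "\<exists>y\<in>carrier (presented_group X R). y \<otimes>\<^bsub>presented_group X R\<^esub> x = \<one>\<^bsub>presented_group X R\<^esub>"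
    using w(1) inverse_word_in_gwords unfolding carrier_presented_group by blast
next
  fix x y
  assume "x \<in> carrier (presented_group X R)" "y \<in> carrier (presented_group X R)"
  then obtain u v where w: "u \<in> gwords X" "x = word_class X R u" "v \<in> gwords X" "y = word_class X R v"
    by (auto simp: carrier_presented_group)
  then show "x \<otimes>\<^bsub>presented_group X R\<^esub> y \<in> carrier (presented_group X R)"
    by (simp add: word_class_closed mult_word_class)
  fix z
  assume "z \<in> carrier (presented_group X R)"
  then obtain t where t: "t \<in> gwords X" "z = word_class X R t"
    by (auto simp: carrier_presented_group)
  with w show "x \<otimes>\<^bsub>presented_group X R\<^esub> y \<otimes>\<^bsub>presented_group X R\<^esub> z
      = x \<otimes>\<^bsub>presented_group X R\<^esub> (y \<otimes>\<^bsub>presented_group X R\<^esub> z)"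
    by (simp add: mult_word_class)
next
  fix x
  assume "x \<in> carrier (presented_group X R)"
  then obtain w where w: "w \<in> gwords X" "x = word_class X R w"
    by (auto simp: carrier_presented_group)
  then show "\<one>\<^bsub>presented_group X R\<^esub> \<otimes>\<^bsub>presented_group X R\<^esub> x = x"
    by (simp add: mult_word_class one_presented_group)
qed (simp add: word_class_closed one_presented_group)

lemma presented_gen_closed: "x \<in> X \<Longrightarrow> presented_gen X R x \<in> carrier (presented_group X R)"
  by (simp add: presented_gen_def word_class_closed)

lemma inv_presented_gen:
  assumes "x \<in> X"
  shows "inv\<^bsub>presented_group X R\<^esub> presented_gen X R x = word_class X R [(x, False)]"
proof -
  interpret group "presented_group X R" by (rule group_presented_group)
  have "([(x, False)] @ [(x, True)], []) \<in> presented_cong X R"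
    using presented_cong.cancel[where u = "[]" and v = "[]" and b = False] assms by simp
  then show ?thesis
    using assms
    by (intro inv_equality)
      (auto simp: presented_gen_def mult_word_class one_presented_group word_class_eq_iff
        word_class_closed)
qed

lemma presented_relation:
  assumes "(positive_word xs, positive_word ys) \<in> R" "set xs \<subseteq> X" "set ys \<subseteq> X"
  shows "word_class X R (positive_word xs) = word_class X R (positive_word ys)"
proof -
  have "positive_word zs \<in> gwords X" if "set zs \<subseteq> X" for zs
    using that by (auto simp: positive_word_def gwords_def)
  then have "positive_word xs \<in> gwords X" "positive_word ys \<in> gwords X"
    using assms by auto
  then show ?thesis
    using presented_cong.relation[where u = "[]" and v = "[]"] assms(1)
    by (simp add: word_class_eq_iff)
qed

lemma eval_gword_closed:
  assumes "group H" "f ` X \<subseteq> carrier H" "w \<in> gwords X"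
  shows "eval_gword H f w \<in> carrier H"
proof -
  interpret group H by fact
  show ?thesis using assms(2,3) by (induction w) auto
qed

lemma eval_gword_append:
  assumes "group H" "f ` X \<subseteq> carrier H" "u \<in> gwords X" "v \<in> gwords X"
  shows "eval_gword H f (u @ v) = eval_gword H f u \<otimes>\<^bsub>H\<^esub> eval_gword H f v"
proof -
  interpret group H by fact
  show ?thesis
    using assms(3)
  proof (induction u)
    case Nil
    then show ?case using eval_gword_closed[OF assms(1,2,4)] by simp
  next
    case (Cons a u)
    have "f (fst a) \<in> carrier H" using Cons.prems assms(2) by auto
    then show ?case
      using Cons assms by (simp add: m_assoc eval_gword_closed[OF assms(1,2)])
  qed
qed

lemma eval_gword_cong:
  assumes "group H" "f ` X \<subseteq> carrier H"
    and rel: "\<And>r s. (r, s) \<in> R \<Longrightarrow> r \<in> gwords X \<Longrightarrow> s \<in> gwords X \<Longrightarrow>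
      eval_gword H f r = eval_gword H f s"
    and "(u, v) \<in> presented_cong X R"
  shows "eval_gword H f u = eval_gword H f v"
proof -
  interpret group H by fact
  note app = eval_gword_append[OF assms(1,2)] and closed = eval_gword_closed[OF assms(1,2)]
  show ?thesis
    using assms(4)
  proof (induction rule: presented_cong.induct)
    case (cancel u v x b)
    then have "f x \<in> carrier H" using assms(2) by auto
    then have "eval_gword H f [(x, b), (x, \<not> b)] = \<one>\<^bsub>H\<^esub>" by simp
    moreover have "[(x, b), (x, \<not> b)] \<in> gwords X" using cancel by simp
    ultimately show ?case
      using cancel closed by (simp add: app del: eval_gword.simps append_Cons append_Nil)
  next
    case (relation u v r s)
    then show ?case using rel by (simp add: app)
  qed auto
qed

locale presented_group_map =
  fixes X :: "'a set" and R :: "('a gword \<times> 'a gword) set" and H :: "('b, 'm) monoid_scheme" and f :: "'a \<Rightarrow> 'b"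
  assumes target: "group H"
    and maps: "f ` X \<subseteq> carrier H"
    and respects: "\<And>r s. (r, s) \<in> R \<Longrightarrow> r \<in> gwords X \<Longrightarrow> s \<in> gwords X \<Longrightarrow>
      eval_gword H f r = eval_gword H f s"
begin

lemma presented_hom_word_class:
  assumes "w \<in> gwords X"
  shows "presented_hom H f (word_class X R w) = eval_gword H f w"
proof -
  have "the_elem (eval_gword H f ` word_class X R w) = eval_gword H f w"
  proof (rule the_elem_image_unique)
    show "word_class X R w \<noteq> {}"
      using assms by (auto intro: presented_cong.refl)
    show "eval_gword H f v = eval_gword H f w" if "v \<in> word_class X R w" for v
      using eval_gword_cong[OF target maps respects, where u = w and v = v] that by simp
  qed
  then show ?thesis by (simp add: presented_hom_def)
qed

lemma presented_hom_hom: "presented_hom H f \<in> hom (presented_group X R) H"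
proof (rule homI)
  fix x y
  assume "x \<in> carrier (presented_group X R)" "y \<in> carrier (presented_group X R)"
  then obtain u v where "u \<in> gwords X" "x = word_class X R u" "v \<in> gwords X" "y = word_class X R v"
    by (auto simp: carrier_presented_group)
  then show "presented_hom H f (x \<otimes>\<^bsub>presented_group X R\<^esub> y) = presented_hom H f x \<otimes>\<^bsub>H\<^esub> presented_hom H f y"
    by (simp add: mult_word_class presented_hom_word_class eval_gword_append[OF target maps])
next
  fix x
  assume "x \<in> carrier (presented_group X R)"
  then show "presented_hom H f x \<in> carrier H"
    by (auto simp: carrier_presented_group presented_hom_word_class eval_gword_closed[OF target maps])
qed

lemma presented_hom_gen:
  assumes "x \<in> X"
  shows "presented_hom H f (presented_gen X R x) = f x"
proof -
  interpret group H by (rule target)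
  have "f x \<in> carrier H" using maps assms by auto
  then show ?thesis
    using assms by (simp add: presented_gen_def presented_hom_word_class)
qed

end

text \<open>A homomorphism is evaluation at its values on the generators, so these values determine
  it.\<close>

lemma presented_group_hom_eval:
  assumes "group H" "\<phi> \<in> hom (presented_group X R) H" "w \<in> gwords X"
  shows "\<phi> (word_class X R w) = eval_gword H (\<lambda>x. \<phi> (presented_gen X R x)) w"
  using assms(3)
proof (induction w)
  case Nil
  then show ?case
    using hom_one[OF assms(2) group_presented_group assms(1)] by (simp add: one_presented_group)
next
  case (Cons a w)
  interpret group_hom "presented_group X R" H \<phi>
    using assms by (simp add: group_hom_def group_hom_axioms_def group_presented_group)
  obtain x b where a: "a = (x, b)" by (cases a)
  have "word_class X R (a # w) = word_class X R [a] \<otimes>\<^bsub>presented_group X R\<^esub> word_class X R w"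
    using Cons.prems by (simp add: mult_word_class)
  moreover have "word_class X R [a] = (if b then presented_gen X R x
      else inv\<^bsub>presented_group X R\<^esub> presented_gen X R x)"
    using Cons.prems by (simp add: a inv_presented_gen) (simp add: presented_gen_def)
  moreover have "word_class X R w \<in> carrier (presented_group X R)"
    using Cons.prems by (simp add: word_class_closed)
  moreover have "presented_gen X R x \<in> carrier (presented_group X R)"
    using Cons.prems by (simp add: a presented_gen_closed)
  ultimately show ?case
    using Cons by (simp add: a)
qed

lemma presented_group_hom_eqI:
  assumes "group H" "\<phi> \<in> hom (presented_group X R) H" "\<psi> \<in> hom (presented_group X R) H"
    and "\<And>x. x \<in> X \<Longrightarrow> \<phi> (presented_gen X R x) = \<psi> (presented_gen X R x)"
    and "c \<in> carrier (presented_group X R)"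
  shows "\<phi> c = \<psi> c"
proof -
  obtain w where w: "w \<in> gwords X" "c = word_class X R w"
    using assms(5) by (auto simp: carrier_presented_group)
  have "eval_gword H (\<lambda>x. \<phi> (presented_gen X R x)) w = eval_gword H (\<lambda>x. \<psi> (presented_gen X R x)) w"
    using w(1) by (induction w) (auto simp: assms(4))
  then show ?thesis
    using presented_group_hom_eval assms w by metis
qed

section \<open>Homomorphisms out of virtual pure braid groups\<close>

lemma group_VP: "group (VP n)"
  by (simp add: VP_def group_presented_group)

lemma VP_gen_closed:
  "i \<in> {1..n} \<Longrightarrow> j \<in> {1..n} \<Longrightarrow> i \<noteq> j \<Longrightarrow> VP_gen n i j \<in> carrier (VP n)"
  by (simp add: VP_gen_def VP_def presented_gen_closed VP_gens_def)

lemma VP_commute: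
  assumes "{i, j, k, l} \<subseteq> {1..n}" "distinct [i, j, k, l]"
  shows "VP_gen n i j \<otimes>\<^bsub>VP n\<^esub> VP_gen n k l = VP_gen n k l \<otimes>\<^bsub>VP n\<^esub> VP_gen n i j"
proof -
  have "(positive_word [(i, j), (k, l)], positive_word [(k, l), (i, j)]) \<in> VP_rels n"
    unfolding VP_rels_def using assms by blast
  then have "word_class (VP_gens n) (VP_rels n) (positive_word [(i, j), (k, l)])
      = word_class (VP_gens n) (VP_rels n) (positive_word [(k, l), (i, j)])"
    by (rule presented_relation) (use assms in \<open>auto simp: VP_gens_def\<close>)
  then show ?thesis
    using assms
    by (simp add: VP_gen_def VP_def presented_gen_def mult_word_class positive_word_def VP_gens_def)
qed

lemma VP_triangle:
  assumes "{i, j, k} \<subseteq> {1..n}" "distinct [i, j, k]"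
  shows "VP_gen n k i \<otimes>\<^bsub>VP n\<^esub> (VP_gen n k j \<otimes>\<^bsub>VP n\<^esub> VP_gen n i j)
    = VP_gen n i j \<otimes>\<^bsub>VP n\<^esub> (VP_gen n k j \<otimes>\<^bsub>VP n\<^esub> VP_gen n k i)"
proof -
  have "(positive_word [(k, i), (k, j), (i, j)], positive_word [(i, j), (k, j), (k, i)]) \<in> VP_rels n"
    unfolding VP_rels_def using assms by blast
  then have "word_class (VP_gens n) (VP_rels n) (positive_word [(k, i), (k, j), (i, j)])
      = word_class (VP_gens n) (VP_rels n) (positive_word [(i, j), (k, j), (k, i)])"
    by (rule presented_relation) (use assms in \<open>auto simp: VP_gens_def\<close>)
  then show ?thesis
    using assms
    by (simp add: VP_gen_def VP_def presented_gen_def mult_word_class positive_word_def VP_gens_def)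
qed

lemma VP_hom_exists:
  assumes H: "group H"
    and closed: "\<And>i j. i \<in> {1..n} \<Longrightarrow> j \<in> {1..n} \<Longrightarrow> i \<noteq> j \<Longrightarrow> f (i, j) \<in> carrier H"
    and commute: "\<And>i j k l. {i, j, k, l} \<subseteq> {1..n} \<Longrightarrow> distinct [i, j, k, l] \<Longrightarrow>
      f (i, j) \<otimes>\<^bsub>H\<^esub> f (k, l) = f (k, l) \<otimes>\<^bsub>H\<^esub> f (i, j)"
    and triangle: "\<And>i j k. {i, j, k} \<subseteq> {1..n} \<Longrightarrow> distinct [i, j, k] \<Longrightarrow>
      f (k, i) \<otimes>\<^bsub>H\<^esub> (f (k, j) \<otimes>\<^bsub>H\<^esub> f (i, j)) = f (i, j) \<otimes>\<^bsub>H\<^esub> (f (k, j) \<otimes>\<^bsub>H\<^esub> f (k, i))"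
  shows "presented_hom H f \<in> hom (VP n) H"
    and "\<And>i j. i \<in> {1..n} \<Longrightarrow> j \<in> {1..n} \<Longrightarrow> i \<noteq> j \<Longrightarrow> presented_hom H f (VP_gen n i j) = f (i, j)"
proof -
  interpret group H by (rule H)
  interpret presented_group_map "VP_gens n" "VP_rels n" H f
  proof (unfold_locales)
    show "f ` VP_gens n \<subseteq> carrier H"
      using closed by (auto simp: VP_gens_def)
    fix r s
    assume "(r, s) \<in> VP_rels n"
    then show "eval_gword H f r = eval_gword H f s"
      unfolding VP_rels_def Un_iff mem_Collect_eq prod.inject
    proof (elim disjE exE conjE)
      fix i j k l
      assume "r = positive_word [(i, j), (k, l)]" "s = positive_word [(k, l), (i, j)]"
        and ran: "{i, j, k, l} \<subseteq> {1..n}" and dist: "distinct [i, j, k, l]"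
      moreover have "f (i, j) \<in> carrier H" "f (k, l) \<in> carrier H"
        using ran dist by (auto intro: closed)
      ultimately show ?thesis
        using commute[OF ran dist] by (simp add: positive_word_def)
    next
      fix i j k
      assume "r = positive_word [(k, i), (k, j), (i, j)]" "s = positive_word [(i, j), (k, j), (k, i)]"
        and ran: "{i, j, k} \<subseteq> {1..n}" and dist: "distinct [i, j, k]"
      moreover have "f (k, i) \<in> carrier H" "f (k, j) \<in> carrier H" "f (i, j) \<in> carrier H"
        using ran dist by (auto intro: closed)
      ultimately show ?thesis
        using triangle[OF ran dist] by (simp add: positive_word_def)
    qed
  qed
  show "presented_hom H f \<in> hom (VP n) H"
    unfolding VP_def by (rule presented_hom_hom)
  show "presented_hom H f (VP_gen n i j) = f (i, j)" if "i \<in> {1..n}" "j \<in> {1..n}" "i \<noteq> j" for i j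
    unfolding VP_gen_def by (rule presented_hom_gen) (use that in \<open>simp add: VP_gens_def\<close>)
qed

lemma VP_hom_eqI:
  assumes "group H" "\<phi> \<in> hom (VP n) H" "\<psi> \<in> hom (VP n) H" "c \<in> carrier (VP n)"
    and "\<And>i j. i \<in> {1..n} \<Longrightarrow> j \<in> {1..n} \<Longrightarrow> i \<noteq> j \<Longrightarrow> \<phi> (VP_gen n i j) = \<psi> (VP_gen n i j)"
  shows "\<phi> c = \<psi> c"
  using assms presented_group_hom_eqI[of H \<phi> "VP_gens n" "VP_rels n" \<psi> c]
  by (auto simp: VP_def VP_gen_def VP_gens_def)

lemma carrier_VP_1: "carrier (VP 1) = {\<one>\<^bsub>VP 1\<^esub>}"
proof -
  have "VP_gens 1 = {}" by (auto simp: VP_gens_def)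
  then have "gwords (VP_gens 1) = {[]}" by (auto simp: gwords_def)
  then show ?thesis
    by (simp only: VP_def carrier_presented_group one_presented_group) simp
qed

section \<open>Faces and degeneracies on generators\<close>

lemma strand_shift_inj:
  "k \<noteq> p \<Longrightarrow> l \<noteq> p \<Longrightarrow> strand_shift p k = strand_shift p l \<longleftrightarrow> k = l"
  by (auto simp: strand_shift_def)

lemma strand_shift_range:
  "k \<in> {1..Suc n} \<Longrightarrow> k \<noteq> p \<Longrightarrow> p \<in> {1..Suc n} \<Longrightarrow> strand_shift p k \<in> {1..n}"
  by (auto simp: strand_shift_def)

text \<open>If the deleted strand occurs in a commutation relation, one factor becomes trivial; if it
  occurs in a triangle relation, two of the three factors do. Otherwise the relation is only
  renumbered.\<close>

lemma VAP_face_props: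
  assumes "i \<le> n"
  shows VAP_face_hom: "VAP_face n i \<in> hom (VP (Suc n)) (VP n)"
    and VAP_face_gen: "\<And>k l. k \<in> {1..Suc n} \<Longrightarrow> l \<in> {1..Suc n} \<Longrightarrow> k \<noteq> l \<Longrightarrow>
      VAP_face n i (VP_gen (Suc n) k l) =
        (if Suc i \<in> {k, l} then \<one>\<^bsub>VP n\<^esub>
         else VP_gen n (strand_shift (Suc i) k) (strand_shift (Suc i) l))"
proof -
  interpret group "VP n" by (rule group_VP)
  define f where "f = (\<lambda>(k, l). if i + 1 \<in> {k, l} then \<one>\<^bsub>VP n\<^esub>
               else VP_gen n (strand_shift (i + 1) k) (strand_shift (i + 1) l))"
  have p: "Suc i \<in> {1..Suc n}" using assms by simp
  have f_eq: "f (k, l) = (if Suc i = k \<or> Suc i = l then \<one>\<^bsub>VP n\<^esub>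
               else VP_gen n (strand_shift (Suc i) k) (strand_shift (Suc i) l))" for k l
    by (simp add: f_def)
  have f_closed: "f (k, l) \<in> carrier (VP n)" if "k \<in> {1..Suc n}" "l \<in> {1..Suc n}" "k \<noteq> l" for k l
    using that p by (simp add: f_eq VP_gen_closed strand_shift_inj strand_shift_range del: atLeastAtMost_iff One_nat_def)
  have f_commute: "f (a, b) \<otimes>\<^bsub>VP n\<^esub> f (c, d) = f (c, d) \<otimes>\<^bsub>VP n\<^esub> f (a, b)"
    if "{a, b, c, d} \<subseteq> {1..Suc n}" "distinct [a, b, c, d]" for a b c d
  proof (cases "Suc i \<in> {a, b, c, d}")
    case True
    have "f (a, b) \<in> carrier (VP n)" "f (c, d) \<in> carrier (VP n)"
      using that by (auto intro!: f_closed)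
    with True show ?thesis by (auto simp: f_eq)
  next
    case False
    then show ?thesis
      using that p
      by (simp add: f_eq del: atLeastAtMost_iff One_nat_def)
        (intro VP_commute; auto simp: strand_shift_inj strand_shift_range simp del: atLeastAtMost_iff One_nat_def)
  qed
  have f_triangle: "f (c, a) \<otimes>\<^bsub>VP n\<^esub> (f (c, b) \<otimes>\<^bsub>VP n\<^esub> f (a, b)) = f (a, b) \<otimes>\<^bsub>VP n\<^esub> (f (c, b) \<otimes>\<^bsub>VP n\<^esub> f (c, a))"
    if "{a, b, c} \<subseteq> {1..Suc n}" "distinct [a, b, c]" for a b c
  proof (cases "Suc i \<in> {a, b, c}")
    case True
    have "f (c, a) \<in> carrier (VP n)" "f (c, b) \<in> carrier (VP n)" "f (a, b) \<in> carrier (VP n)"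
      using that by (auto intro!: f_closed)
    with True show ?thesis by (auto simp: f_eq)
  next
    case False
    then show ?thesis
      using that p
      by (simp add: f_eq del: atLeastAtMost_iff One_nat_def)
        (intro VP_triangle; auto simp: strand_shift_inj strand_shift_range simp del: atLeastAtMost_iff One_nat_def)
  qed
  have face: "VAP_face n i = presented_hom (VP n) f"
    by (simp add: VAP_face_def f_def)
  show "VAP_face n i \<in> hom (VP (Suc n)) (VP n)"
    unfolding face by (rule VP_hom_exists(1)[OF group_VP]) (fact f_closed f_commute f_triangle)+
  show "VAP_face n i (VP_gen (Suc n) k l) =
        (if Suc i \<in> {k, l} then \<one>\<^bsub>VP n\<^esub>
         else VP_gen n (strand_shift (Suc i) k) (strand_shift (Suc i) l))"
    if "k \<in> {1..Suc n}" "l \<in> {1..Suc n}" "k \<noteq> l" for k l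
  proof -
    have "VAP_face n i (VP_gen (Suc n) k l) = f (k, l)"
      unfolding face
      by (rule VP_hom_exists(2)[OF group_VP _ _ _ that]) (fact f_closed f_commute f_triangle)+
    then show ?thesis by (simp add: f_eq)
  qed
qed

definition strand_unshift :: "nat \<Rightarrow> nat \<Rightarrow> nat" where
  "strand_unshift p m = (if m < p then m else Suc m)"

text \<open>The two tables that define the degeneracies, for \<open>\<lambda>\<^sub>k\<^sub>l\<close> and for \<open>\<lambda>\<^sub>l\<^sub>k\<close>, follow one rule
  that does not compare the two indices: a doubled first index runs upwards and a doubled second
  index runs downwards.\<close>

definition double_strand :: "nat \<Rightarrow> nat \<Rightarrow> nat \<Rightarrow> nat \<Rightarrow> (nat \<times> nat) gword set" where
  "double_strand N p a b =
     (if a = p then VP_gen N p (strand_unshift p b) \<otimes>\<^bsub>VP N\<^esub> VP_gen N (Suc p) (strand_unshift p b)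
      else if b = p then VP_gen N (strand_unshift p a) (Suc p) \<otimes>\<^bsub>VP N\<^esub> VP_gen N (strand_unshift p a) p
      else VP_gen N (strand_unshift p a) (strand_unshift p b))"

lemma double_strand_eq:
  "a \<noteq> b \<Longrightarrow> (if a < b then double_strand_kl N p a b else double_strand_lk N p a b) = double_strand N p a b"
  by (auto simp: double_strand_kl_def double_strand_lk_def double_strand_def strand_unshift_def)


lemma strand_unshift_range: "k \<in> {1..n} \<Longrightarrow> strand_unshift p k \<in> {1..Suc n}"
  by (auto simp: strand_unshift_def)

lemma strand_unshift_inj: "strand_unshift p k = strand_unshift p l \<longleftrightarrow> k = l"
  by (auto simp: strand_unshift_def)

lemma strand_unshift_avoids:
  assumes "k \<noteq> p"
  shows "strand_unshift p k \<noteq> p" "strand_unshift p k \<noteq> Suc p"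
    "p \<noteq> strand_unshift p k" "Suc p \<noteq> strand_unshift p k"
  using assms by (auto simp: strand_unshift_def)

lemma doubled_strand_range: "p \<in> {1..n} \<Longrightarrow> p \<in> {1..Suc n} \<and> Suc p \<in> {1..Suc n}"
  by auto

lemmas strand_unshift_facts =
  strand_unshift_range strand_unshift_inj strand_unshift_avoids doubled_strand_range

lemma double_strand_closed:
  assumes "p \<in> {1..n}" "a \<in> {1..n}" "b \<in> {1..n}" "a \<noteq> b"
  shows "double_strand (Suc n) p a b \<in> carrier (VP (Suc n))"
proof -
  interpret group "VP (Suc n)" by (rule group_VP)
  show ?thesis
    using assms
    by (auto intro!: m_closed VP_gen_closed simp: double_strand_def strand_unshift_facts
        simp del: atLeastAtMost_iff One_nat_def)
qed

context monoid
begin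

lemma mult_commutes:
  assumes "x \<in> carrier G" "y \<in> carrier G" "z \<in> carrier G" "x \<otimes> z = z \<otimes> x" "y \<otimes> z = z \<otimes> y"
  shows "(x \<otimes> y) \<otimes> z = z \<otimes> (x \<otimes> y)"
  using assms by (metis m_assoc)

lemma commutes_left:
  assumes "x \<otimes> y = y \<otimes> x" "x \<in> carrier G" "y \<in> carrier G" "z \<in> carrier G"
  shows "x \<otimes> (y \<otimes> z) = y \<otimes> (x \<otimes> z)"
  using assms by (metis m_assoc)

text \<open>In the triangle relation \<open>\<lambda>\<^sub>k\<^sub>i \<lambda>\<^sub>k\<^sub>j \<lambda>\<^sub>i\<^sub>j = \<lambda>\<^sub>i\<^sub>j \<lambda>\<^sub>k\<^sub>j \<lambda>\<^sub>k\<^sub>i\<close> let \<open>x\<close>, \<open>y\<close>, \<open>z\<close> be the values of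
  \<open>\<lambda>\<^sub>k\<^sub>i\<close>, \<open>\<lambda>\<^sub>k\<^sub>j\<close>, \<open>\<lambda>\<^sub>i\<^sub>j\<close>. Doubling a strand doubles the two factors that contain it, and the next
  three lemmas treat the doubling of \<open>k\<close>, \<open>i\<close> and \<open>j\<close>; primes mark the second copy of the strand.
  The primed copy of one doubled factor and the unprimed copy of the other live on disjoint pairs
  of strands, hence commute. Moving them past each other brings together three factors on the same
  copy, to which a triangle relation applies.\<close>

lemma triangle_double_first:
  assumes [simp]: "x \<in> carrier G" "x' \<in> carrier G" "y \<in> carrier G" "y' \<in> carrier G" "z \<in> carrier G"
    and "x' \<otimes> y = y \<otimes> x'" "x \<otimes> y' = y' \<otimes> x"
    and "x \<otimes> (y \<otimes> z) = z \<otimes> (y \<otimes> x)" "x' \<otimes> (y' \<otimes> z) = z \<otimes> (y' \<otimes> x')"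
  shows "(x \<otimes> x') \<otimes> ((y \<otimes> y') \<otimes> z) = z \<otimes> ((y \<otimes> y') \<otimes> (x \<otimes> x'))"
proof -
  have "(x \<otimes> x') \<otimes> ((y \<otimes> y') \<otimes> z) = x \<otimes> ((x' \<otimes> y) \<otimes> (y' \<otimes> z))"
    by (simp add: m_assoc)
  also have "\<dots> = x \<otimes> (y \<otimes> (x' \<otimes> (y' \<otimes> z)))"
    by (simp only: assms(6)) (simp add: m_assoc)
  also have "\<dots> = (x \<otimes> (y \<otimes> z)) \<otimes> (y' \<otimes> x')"
    by (simp only: assms(9)) (simp add: m_assoc)
  also have "\<dots> = z \<otimes> (y \<otimes> ((x \<otimes> y') \<otimes> x'))"
    by (simp only: assms(8)) (simp add: m_assoc)
  also have "\<dots> = z \<otimes> ((y \<otimes> y') \<otimes> (x \<otimes> x'))"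
    by (simp only: assms(7)) (simp add: m_assoc)
  finally show ?thesis .
qed

lemma triangle_double_middle:
  assumes [simp]: "x \<in> carrier G" "x' \<in> carrier G" "y \<in> carrier G" "z \<in> carrier G" "z' \<in> carrier G"
    and "x \<otimes> z' = z' \<otimes> x" "x' \<otimes> z = z \<otimes> x'"
    and "x \<otimes> (y \<otimes> z) = z \<otimes> (y \<otimes> x)" "x' \<otimes> (y \<otimes> z') = z' \<otimes> (y \<otimes> x')"
  shows "(x' \<otimes> x) \<otimes> (y \<otimes> (z \<otimes> z')) = (z \<otimes> z') \<otimes> (y \<otimes> (x' \<otimes> x))"
proof -
  have "(x' \<otimes> x) \<otimes> (y \<otimes> (z \<otimes> z')) = x' \<otimes> ((x \<otimes> (y \<otimes> z)) \<otimes> z')"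
    by (simp add: m_assoc)
  also have "\<dots> = (x' \<otimes> z) \<otimes> (y \<otimes> (x \<otimes> z'))"
    by (simp only: assms(8)) (simp add: m_assoc)
  also have "\<dots> = z \<otimes> ((x' \<otimes> (y \<otimes> z')) \<otimes> x)"
    by (simp only: assms(6,7)) (simp add: m_assoc)
  also have "\<dots> = (z \<otimes> z') \<otimes> (y \<otimes> (x' \<otimes> x))"
    by (simp only: assms(9)) (simp add: m_assoc)
  finally show ?thesis .
qed

lemma triangle_double_last:
  assumes [simp]: "x \<in> carrier G" "y \<in> carrier G" "y' \<in> carrier G" "z \<in> carrier G" "z' \<in> carrier G"
    and "y \<otimes> z' = z' \<otimes> y" "y' \<otimes> z = z \<otimes> y'"
    and "x \<otimes> (y \<otimes> z) = z \<otimes> (y \<otimes> x)" "x \<otimes> (y' \<otimes> z') = z' \<otimes> (y' \<otimes> x)"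
  shows "x \<otimes> ((y' \<otimes> y) \<otimes> (z' \<otimes> z)) = (z' \<otimes> z) \<otimes> ((y' \<otimes> y) \<otimes> x)"
proof -
  have "x \<otimes> ((y' \<otimes> y) \<otimes> (z' \<otimes> z)) = x \<otimes> (y' \<otimes> ((y \<otimes> z') \<otimes> z))"
    by (simp add: m_assoc)
  also have "\<dots> = (x \<otimes> (y' \<otimes> z')) \<otimes> (y \<otimes> z)"
    by (simp only: assms(6)) (simp add: m_assoc)
  also have "\<dots> = z' \<otimes> (y' \<otimes> (x \<otimes> (y \<otimes> z)))"
    by (simp only: assms(9)) (simp add: m_assoc)
  also have "\<dots> = z' \<otimes> ((y' \<otimes> z) \<otimes> (y \<otimes> x))"
    by (simp only: assms(8)) (simp add: m_assoc)
  also have "\<dots> = (z' \<otimes> z) \<otimes> ((y' \<otimes> y) \<otimes> x)"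
    by (simp only: assms(7)) (simp add: m_assoc)
  finally show ?thesis .
qed

end

lemma double_strand_commute:
  assumes "p \<in> {1..n}" and ran: "{a, b, c, d} \<subseteq> {1..n}" and "distinct [a, b, c, d]"
  shows "double_strand (Suc n) p a b \<otimes>\<^bsub>VP (Suc n)\<^esub> double_strand (Suc n) p c d
    = double_strand (Suc n) p c d \<otimes>\<^bsub>VP (Suc n)\<^esub> double_strand (Suc n) p a b"
proof -
  interpret group "VP (Suc n)" by (rule group_VP)
  \<comment> \<open>The strand \<open>p\<close> lies in at most one of the two disjoint pairs, so by symmetry the second pair
    may be assumed to avoid it.\<close>
  have *: "double_strand (Suc n) p a b \<otimes>\<^bsub>VP (Suc n)\<^esub> double_strand (Suc n) p c d
    = double_strand (Suc n) p c d \<otimes>\<^bsub>VP (Suc n)\<^esub> double_strand (Suc n) p a b"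
    if ran: "{a, b, c, d} \<subseteq> {1..n}" and dist: "distinct [a, b, c, d]" and "c \<noteq> p" "d \<noteq> p" for a b c d
  proof -
    have cd: "double_strand (Suc n) p c d = VP_gen (Suc n) (strand_unshift p c) (strand_unshift p d)"
      using that by (simp add: double_strand_def)
    note side = VP_gen_closed VP_commute
    consider "a = p" | "b = p" "a \<noteq> p" | "a \<noteq> p" "b \<noteq> p" by blast
    then show ?thesis
    proof cases
      case 1
      then show ?thesis
        using that assms(1) unfolding cd
        by (simp add: double_strand_def del: atLeastAtMost_iff One_nat_def) (intro mult_commutes side; auto simp: strand_unshift_facts simp del: atLeastAtMost_iff One_nat_def)
    next
      case 2
      then show ?thesis
        using that assms(1) unfolding cd
        by (simp add: double_strand_def del: atLeastAtMost_iff One_nat_def) (intro mult_commutes side; auto simp: strand_unshift_facts simp del: atLeastAtMost_iff One_nat_def)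
    next
      case 3
      then show ?thesis
        using that assms(1) unfolding cd
        by (simp add: double_strand_def del: atLeastAtMost_iff One_nat_def) (intro side; auto simp: strand_unshift_facts simp del: atLeastAtMost_iff One_nat_def)
    qed
  qed
  show ?thesis
  proof (cases "p \<in> {c, d}")
    case True
    then have "a \<noteq> p" "b \<noteq> p" using assms by auto
    then show ?thesis
      using assms by (intro *[of c d a b, symmetric]) auto
  next
    case False
    then show ?thesis using assms by (intro *) auto
  qed
qed

lemma double_strand_triangle:
  assumes "p \<in> {1..n}" "{i, j, k} \<subseteq> {1..n}" "distinct [i, j, k]"
  defines "D \<equiv> double_strand (Suc n) p"
  shows "D k i \<otimes>\<^bsub>VP (Suc n)\<^esub> (D k j \<otimes>\<^bsub>VP (Suc n)\<^esub> D i j)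
    = D i j \<otimes>\<^bsub>VP (Suc n)\<^esub> (D k j \<otimes>\<^bsub>VP (Suc n)\<^esub> D k i)"
proof -
  interpret group "VP (Suc n)" by (rule group_VP)
  note D = D_def double_strand_def
  note side = VP_gen_closed VP_commute VP_triangle
  consider "k = p" | "i = p" | "j = p" | "k \<noteq> p" "i \<noteq> p" "j \<noteq> p" by auto
  then show ?thesis
  proof cases
    case 1
    then show ?thesis
      using assms(1-3) by (simp add: D del: atLeastAtMost_iff One_nat_def) (intro triangle_double_first side; auto simp: strand_unshift_facts simp del: atLeastAtMost_iff One_nat_def)
  next
    case 2
    then show ?thesis
      using assms(1-3) by (simp add: D del: atLeastAtMost_iff One_nat_def) (intro triangle_double_middle side; auto simp: strand_unshift_facts simp del: atLeastAtMost_iff One_nat_def)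
  next
    case 3
    then show ?thesis
      using assms(1-3) by (simp add: D del: atLeastAtMost_iff One_nat_def) (intro triangle_double_last side; auto simp: strand_unshift_facts simp del: atLeastAtMost_iff One_nat_def)
  next
    case 4
    then show ?thesis
      using assms(1-3) by (simp add: D del: atLeastAtMost_iff One_nat_def) (intro side; auto simp: strand_unshift_facts simp del: atLeastAtMost_iff One_nat_def)
  qed
qed

lemma VAP_degen_props:
  assumes "i \<le> n"
  shows VAP_degen_hom: "VAP_degen n i \<in> hom (VP (Suc n)) (VP (Suc (Suc n)))"
    and VAP_degen_gen: "\<And>a b. a \<in> {1..Suc n} \<Longrightarrow> b \<in> {1..Suc n} \<Longrightarrow> a \<noteq> b \<Longrightarrow>
      VAP_degen n i (VP_gen (Suc n) a b) = double_strand (Suc (Suc n)) (Suc i) a b"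
proof -
  define f where "f = (\<lambda>(a, b). if a < b then double_strand_kl (n + 2) (i + 1) a b
               else double_strand_lk (n + 2) (i + 1) a b)"
  have p: "Suc i \<in> {1..Suc n}" using assms by simp
  have f_eq: "f (a, b) = double_strand (Suc (Suc n)) (Suc i) a b" if "a \<noteq> b" for a b
    using double_strand_eq[OF that] by (simp add: f_def)
  have f_closed: "f (a, b) \<in> carrier (VP (Suc (Suc n)))"
    if "a \<in> {1..Suc n}" "b \<in> {1..Suc n}" "a \<noteq> b" for a b
    unfolding f_eq[OF that(3)] using that p by (intro double_strand_closed)
  have f_commute: "f (a, b) \<otimes>\<^bsub>VP (Suc (Suc n))\<^esub> f (c, d) = f (c, d) \<otimes>\<^bsub>VP (Suc (Suc n))\<^esub> f (a, b)"
    if "{a, b, c, d} \<subseteq> {1..Suc n}" "distinct [a, b, c, d]" for a b c d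
    using double_strand_commute[OF p that] that(2) by (simp add: f_eq)
  have f_triangle: "f (c, a) \<otimes>\<^bsub>VP (Suc (Suc n))\<^esub> (f (c, b) \<otimes>\<^bsub>VP (Suc (Suc n))\<^esub> f (a, b))
      = f (a, b) \<otimes>\<^bsub>VP (Suc (Suc n))\<^esub> (f (c, b) \<otimes>\<^bsub>VP (Suc (Suc n))\<^esub> f (c, a))"
    if "{a, b, c} \<subseteq> {1..Suc n}" "distinct [a, b, c]" for a b c
    using double_strand_triangle[OF p that] that(2) by (simp add: f_eq)
  have degen: "VAP_degen n i = presented_hom (VP (Suc (Suc n))) f"
    by (simp add: VAP_degen_def f_def)
  show "VAP_degen n i \<in> hom (VP (Suc n)) (VP (Suc (Suc n)))"
    unfolding degen by (rule VP_hom_exists(1)[OF group_VP]) (fact f_closed f_commute f_triangle)+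
  show "VAP_degen n i (VP_gen (Suc n) a b) = double_strand (Suc (Suc n)) (Suc i) a b"
    if "a \<in> {1..Suc n}" "b \<in> {1..Suc n}" "a \<noteq> b" for a b
    unfolding degen f_eq[OF that(3), symmetric]
    by (rule VP_hom_exists(2)[OF group_VP _ _ _ that]) (fact f_closed f_commute f_triangle)+
qed

section \<open>The simplicial identities\<close>

lemma VAP_face_mult:
  "i \<le> n \<Longrightarrow> x \<in> carrier (VP (Suc n)) \<Longrightarrow> y \<in> carrier (VP (Suc n)) \<Longrightarrow>
    VAP_face n i (x \<otimes>\<^bsub>VP (Suc n)\<^esub> y) = VAP_face n i x \<otimes>\<^bsub>VP n\<^esub> VAP_face n i y"
  by (rule hom_mult[OF VAP_face_hom])

lemma VAP_face_one: "i \<le> n \<Longrightarrow> VAP_face n i \<one>\<^bsub>VP (Suc n)\<^esub> = \<one>\<^bsub>VP n\<^esub>"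
  by (rule hom_one[OF VAP_face_hom group_VP group_VP])

lemma VAP_degen_mult:
  "i \<le> n \<Longrightarrow> x \<in> carrier (VP (Suc n)) \<Longrightarrow> y \<in> carrier (VP (Suc n)) \<Longrightarrow>
    VAP_degen n i (x \<otimes>\<^bsub>VP (Suc n)\<^esub> y) = VAP_degen n i x \<otimes>\<^bsub>VP (Suc (Suc n))\<^esub> VAP_degen n i y"
  by (rule hom_mult[OF VAP_degen_hom])

lemma VAP_degen_one: "i \<le> n \<Longrightarrow> VAP_degen n i \<one>\<^bsub>VP (Suc n)\<^esub> = \<one>\<^bsub>VP (Suc (Suc n))\<^esub>"
  by (rule hom_one[OF VAP_degen_hom group_VP group_VP])

lemma VP_id_hom: "id \<in> hom (VP n) (VP n)"
  by (simp add: hom_def)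

lemma VP_comp_eqI:
  assumes "\<phi> \<in> hom (VP m) (VP n)" "\<psi> \<in> hom (VP n) (VP l)"
    and "\<phi>' \<in> hom (VP m) (VP n')" "\<psi>' \<in> hom (VP n') (VP l)" "x \<in> carrier (VP m)"
    and "\<And>i j. i \<in> {1..m} \<Longrightarrow> j \<in> {1..m} \<Longrightarrow> i \<noteq> j \<Longrightarrow>
      \<psi> (\<phi> (VP_gen m i j)) = \<psi>' (\<phi>' (VP_gen m i j))"
  shows "\<psi> (\<phi> x) = \<psi>' (\<phi>' x)"
proof -
  have "(\<psi> \<circ> \<phi>) x = (\<psi>' \<circ> \<phi>') x"
    by (rule VP_hom_eqI[OF group_VP Group.hom_compose[OF assms(1,2)] Group.hom_compose[OF assms(3,4)] assms(5)], unfold comp_apply)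
      (rule assms(6))
  then show ?thesis by simp
qed

lemma strand_shift_shift:
  "p \<le> q \<Longrightarrow> k \<noteq> p \<Longrightarrow> k \<noteq> Suc q \<Longrightarrow>
    strand_shift p (strand_shift (Suc q) k) = strand_shift q (strand_shift p k)"
  "p \<le> q \<Longrightarrow> k \<noteq> Suc q \<Longrightarrow> p = strand_shift (Suc q) k \<longleftrightarrow> p = k"
  "p \<le> q \<Longrightarrow> k \<noteq> p \<Longrightarrow> q = strand_shift p k \<longleftrightarrow> Suc q = k"
  by (auto simp: strand_shift_def)

lemma VAP_face_face:
  assumes "i < j" "j \<le> Suc n" "x \<in> carrier (VP (Suc (Suc n)))"
  shows "VAP_face n i (VAP_face (Suc n) j x) = VAP_face n (j - 1) (VAP_face (Suc n) i x)"
proof (rule VP_comp_eqI[OF VAP_face_hom VAP_face_hom VAP_face_hom VAP_face_hom assms(3)])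
  fix a b
  assume ab: "a \<in> {1..Suc (Suc n)}" "b \<in> {1..Suc (Suc n)}" "a \<noteq> b"
  obtain j' where j: "j = Suc j'" using assms by (cases j) auto
  have "Suc i \<le> Suc j'" "i \<le> n" "j' \<le> n" "i \<le> Suc n" "j \<le> Suc n"
    "Suc i \<in> {1..Suc (Suc n)}" "Suc (Suc j') \<in> {1..Suc (Suc n)}"
    using assms(1,2) j by auto
  then show "VAP_face n i (VAP_face (Suc n) j (VP_gen (Suc (Suc n)) a b))
      = VAP_face n (j - 1) (VAP_face (Suc n) i (VP_gen (Suc (Suc n)) a b))"
    using ab
    by (simp add: j VAP_face_gen VAP_face_one strand_shift_inj strand_shift_range strand_shift_shift
        del: One_nat_def atLeastAtMost_iff)
qed (use assms in auto)

lemma strand_shift_unshift_less: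
  "p \<le> q \<Longrightarrow> k \<noteq> p \<Longrightarrow> strand_shift p (strand_unshift (Suc q) k) = strand_unshift q (strand_shift p k)"
  "p \<le> q \<Longrightarrow> p = strand_unshift (Suc q) k \<longleftrightarrow> p = k"
  "p \<le> q \<Longrightarrow> k \<noteq> p \<Longrightarrow> strand_shift p k = q \<longleftrightarrow> k = Suc q"
  "p \<le> q \<Longrightarrow> k \<noteq> p \<Longrightarrow> q = strand_shift p k \<longleftrightarrow> k = Suc q"
  "p \<le> q \<Longrightarrow> strand_shift p (Suc q) = q"
  "p \<le> q \<Longrightarrow> strand_shift p (Suc (Suc q)) = Suc q"
  by (auto simp: strand_shift_def strand_unshift_def)

lemma VAP_face_degen_less:
  assumes "i < j" "j \<le> Suc n" "x \<in> carrier (VP (Suc (Suc n)))"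
  shows "VAP_face (Suc (Suc n)) i (VAP_degen (Suc n) j x) = VAP_degen n (j - 1) (VAP_face (Suc n) i x)"
proof (rule VP_comp_eqI[OF VAP_degen_hom VAP_face_hom VAP_face_hom VAP_degen_hom assms(3)])
  interpret group "VP (Suc (Suc n))" by (rule group_VP)
  fix a b
  assume ab: "a \<in> {1..Suc (Suc n)}" "b \<in> {1..Suc (Suc n)}" "a \<noteq> b"
  obtain j' where j: "j = Suc j'" using assms by (cases j) auto
  have side: "Suc i \<le> Suc j'" "Suc i \<noteq> Suc j" "Suc i \<noteq> Suc (Suc j)" "i \<le> n" "j' \<le> n" "i \<le> Suc n" "i \<le> Suc (Suc n)" "j \<le> Suc n"
    "Suc i \<in> {1..Suc (Suc n)}" "Suc (Suc j') \<in> {1..Suc (Suc n)}" "Suc j' \<in> {1..Suc n}"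
    using assms(1,2) j by auto
  note rules = VAP_face_gen VAP_face_one VAP_face_mult VAP_degen_gen VAP_degen_one
    double_strand_def VP_gen_closed strand_shift_inj strand_shift_range strand_unshift_facts
    strand_shift_unshift_less
  consider "a = Suc j" "b \<noteq> Suc j" | "b = Suc j" "a \<noteq> Suc j" | "a \<noteq> Suc j" "b \<noteq> Suc j"
    using ab(3) by blast
  then show "VAP_face (Suc (Suc n)) i (VAP_degen (Suc n) j (VP_gen (Suc (Suc n)) a b))
      = VAP_degen n (j - 1) (VAP_face (Suc n) i (VP_gen (Suc (Suc n)) a b))"
    using side ab
    by cases (simp_all add: j rules del: One_nat_def atLeastAtMost_iff)
qed (use assms in auto)

lemma strand_shift_unshift_same:
  "k \<noteq> q \<Longrightarrow> strand_shift q (strand_unshift q k) = k"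
  "k \<noteq> q \<Longrightarrow> strand_shift (Suc q) (strand_unshift q k) = k"
  "strand_shift q (Suc q) = q" "strand_shift (Suc q) q = q"
  by (auto simp: strand_shift_def strand_unshift_def)

lemma VAP_face_degen_same:
  assumes "j \<le> n" "i = j \<or> i = Suc j" "x \<in> carrier (VP (Suc n))"
  shows "VAP_face (Suc n) i (VAP_degen n j x) = x"
proof -
  interpret group "VP (Suc n)" by (rule group_VP)
  have "VAP_face (Suc n) i (VAP_degen n j x) = id (id x)"
  proof (rule VP_comp_eqI[OF VAP_degen_hom VAP_face_hom VP_id_hom VP_id_hom assms(3)])
    fix a b
    assume ab: "a \<in> {1..Suc n}" "b \<in> {1..Suc n}" "a \<noteq> b"
    have side: "i \<le> Suc n" "Suc j \<in> {1..Suc n}"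
      using assms(1,2) by auto
    note rules = VAP_face_gen VAP_face_mult VAP_degen_gen
      double_strand_def VP_gen_closed strand_unshift_facts strand_shift_unshift_same
    consider "a = Suc j" "b \<noteq> Suc j" | "b = Suc j" "a \<noteq> Suc j" | "a \<noteq> Suc j" "b \<noteq> Suc j"
      using ab(3) by blast
    then show "VAP_face (Suc n) i (VAP_degen n j (VP_gen (Suc n) a b)) = id (id (VP_gen (Suc n) a b))"
      using assms(1,2) side ab
      by cases (elim disjE; simp add: rules del: One_nat_def atLeastAtMost_iff)+
  qed (use assms in auto)
  then show ?thesis by simp
qed

lemma strand_shift_unshift_greater:
  "q < p \<Longrightarrow> k \<noteq> p \<Longrightarrow> strand_shift (Suc p) (strand_unshift q k) = strand_unshift q (strand_shift p k)"
  "q < p \<Longrightarrow> Suc p = strand_unshift q k \<longleftrightarrow> p = k"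
  "q < p \<Longrightarrow> k \<noteq> p \<Longrightarrow> strand_shift p k = q \<longleftrightarrow> k = q"
  "q < p \<Longrightarrow> k \<noteq> p \<Longrightarrow> q = strand_shift p k \<longleftrightarrow> k = q"
  "q < p \<Longrightarrow> strand_shift p q = q"
  "q < p \<Longrightarrow> strand_shift (Suc p) q = q"
  "q < p \<Longrightarrow> strand_shift (Suc p) (Suc q) = Suc q"
  by (auto simp: strand_shift_def strand_unshift_def)

lemma VAP_face_degen_greater:
  assumes "Suc j < i" "i \<le> Suc (Suc n)" "x \<in> carrier (VP (Suc (Suc n)))"
  shows "VAP_face (Suc (Suc n)) i (VAP_degen (Suc n) j x) = VAP_degen n j (VAP_face (Suc n) (i - 1) x)"
proof (rule VP_comp_eqI[OF VAP_degen_hom VAP_face_hom VAP_face_hom VAP_degen_hom assms(3)])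
  interpret group "VP (Suc (Suc n))" by (rule group_VP)
  fix a b
  assume ab: "a \<in> {1..Suc (Suc n)}" "b \<in> {1..Suc (Suc n)}" "a \<noteq> b"
  obtain i' where i: "i = Suc i'" using assms by (cases i) auto
  have side: "Suc j < Suc i'" "Suc (Suc i') \<noteq> Suc j" "Suc (Suc i') \<noteq> Suc (Suc j)" "i' \<le> Suc n" "i \<le> Suc (Suc n)" "j \<le> n" "j \<le> Suc n"
    "Suc i' \<in> {1..Suc (Suc n)}" "Suc j \<in> {1..Suc n}"
    using assms(1,2) i by auto
  note rules = VAP_face_gen VAP_face_one VAP_face_mult VAP_degen_gen VAP_degen_one
    double_strand_def VP_gen_closed strand_shift_inj strand_shift_range strand_unshift_facts
    strand_shift_unshift_greater
  consider "a = Suc j" "b \<noteq> Suc j" | "b = Suc j" "a \<noteq> Suc j" | "a \<noteq> Suc j" "b \<noteq> Suc j"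
    using ab(3) by blast
  then show "VAP_face (Suc (Suc n)) i (VAP_degen (Suc n) j (VP_gen (Suc (Suc n)) a b))
      = VAP_degen n j (VAP_face (Suc n) (i - 1) (VP_gen (Suc (Suc n)) a b))"
    using side ab
    by cases (simp_all add: i rules del: One_nat_def atLeastAtMost_iff)
qed (use assms in auto)


lemma strand_unshift_unshift_same:
  "k \<noteq> p \<Longrightarrow> strand_unshift p (strand_unshift p k) = strand_unshift (Suc p) (strand_unshift p k)"
  "k \<noteq> p \<Longrightarrow> strand_unshift (Suc p) (strand_unshift p k) \<noteq> p"
  "k \<noteq> p \<Longrightarrow> strand_unshift (Suc p) (strand_unshift p k) \<noteq> Suc p"
  "k \<noteq> p \<Longrightarrow> strand_unshift (Suc p) (strand_unshift p k) \<noteq> Suc (Suc p)"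
  "k \<noteq> p \<Longrightarrow> p \<noteq> strand_unshift (Suc p) (strand_unshift p k)"
  "k \<noteq> p \<Longrightarrow> Suc p \<noteq> strand_unshift (Suc p) (strand_unshift p k)"
  "k \<noteq> p \<Longrightarrow> Suc (Suc p) \<noteq> strand_unshift (Suc p) (strand_unshift p k)"
  "strand_unshift p p = Suc p" "strand_unshift p (Suc p) = Suc (Suc p)"
  "strand_unshift (Suc p) p = p" "strand_unshift (Suc p) (Suc p) = Suc (Suc p)"
  by (auto simp: strand_unshift_def)

lemma strand_unshift_unshift_less:
  "p < q \<Longrightarrow> strand_unshift p (strand_unshift q k) = strand_unshift (Suc q) (strand_unshift p k)"
  "p < q \<Longrightarrow> strand_unshift q k = p \<longleftrightarrow> k = p"
  "p < q \<Longrightarrow> p = strand_unshift q k \<longleftrightarrow> k = p"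
  "p < q \<Longrightarrow> strand_unshift p k = Suc q \<longleftrightarrow> k = q"
  "p < q \<Longrightarrow> Suc q = strand_unshift p k \<longleftrightarrow> k = q"
  "p < q \<Longrightarrow> strand_unshift p q = Suc q" "p < q \<Longrightarrow> strand_unshift p (Suc q) = Suc (Suc q)"
  "p < q \<Longrightarrow> strand_unshift q p = p"
  "p < q \<Longrightarrow> strand_unshift (Suc q) p = p" "p < q \<Longrightarrow> strand_unshift (Suc q) (Suc p) = Suc p"
  by (auto simp: strand_unshift_def)

lemma VAP_degen_degen:
  assumes "i \<le> j" "j \<le> n" "x \<in> carrier (VP (Suc n))"
  shows "VAP_degen (Suc n) i (VAP_degen n j x) = VAP_degen (Suc n) (Suc j) (VAP_degen n i x)"
proof (rule VP_comp_eqI[OF VAP_degen_hom VAP_degen_hom VAP_degen_hom VAP_degen_hom assms(3)])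
  interpret N: group "VP (Suc (Suc (Suc n)))" by (rule group_VP)
  fix a b
  assume ab: "a \<in> {1..Suc n}" "b \<in> {1..Suc n}" "a \<noteq> b"
  have p: "Suc i \<in> {1..Suc n}" and q: "Suc j \<in> {1..Suc n}"
    using assms by auto
  have range: "k \<in> {1..Suc (Suc n)} \<and> k \<in> {1..Suc (Suc (Suc n))} \<and> Suc k \<in> {1..Suc (Suc n)}
      \<and> Suc k \<in> {1..Suc (Suc (Suc n))} \<and> Suc (Suc k) \<in> {1..Suc (Suc (Suc n))}"
    if "k \<in> {1..Suc n}" for k
    using that by auto
  have range': "strand_unshift p k \<in> {1..Suc (Suc n)} \<and> strand_unshift p' (strand_unshift p k) \<in> {1..Suc (Suc (Suc n))}"
    if "k \<in> {1..Suc n}" for k p p'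
    using that by (auto simp: strand_unshift_def)
  note rules = VAP_degen_gen VAP_degen_mult double_strand_def VP_gen_closed
    strand_unshift_inj strand_unshift_avoids range[OF p] range[OF q] range' N.m_assoc
  show "VAP_degen (Suc n) i (VAP_degen n j (VP_gen (Suc n) a b))
      = VAP_degen (Suc n) (Suc j) (VAP_degen n i (VP_gen (Suc n) a b))"
  proof (cases "i = j")
    case True
    consider "a = Suc j" "b \<noteq> Suc j" | "b = Suc j" "a \<noteq> Suc j" | "a \<noteq> Suc j" "b \<noteq> Suc j"
      using ab(3) by blast
    then show ?thesis
      using True assms(2) ab p q
      by cases (simp_all add: rules strand_unshift_unshift_same del: One_nat_def atLeastAtMost_iff)
  next
    case False
    then have less: "Suc i < Suc j" using assms by simp
    let ?G = "VP (Suc (Suc (Suc n)))" and ?g = "VP_gen (Suc (Suc (Suc n)))"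
    let ?p = "Suc i" and ?q = "Suc j"
    \<comment> \<open>A generator joining \<open>p\<close> and \<open>q\<close> becomes a product of four; the two orders of doubling list
      its two middle factors, which have disjoint indices, in opposite order.\<close>
    have swap_up: "?g (Suc ?p) (Suc (Suc ?q)) \<otimes>\<^bsub>?G\<^esub> (?g ?p (Suc ?q) \<otimes>\<^bsub>?G\<^esub> z)
        = ?g ?p (Suc ?q) \<otimes>\<^bsub>?G\<^esub> (?g (Suc ?p) (Suc (Suc ?q)) \<otimes>\<^bsub>?G\<^esub> z)"
      if "z \<in> carrier ?G" for z
      by (rule N.commutes_left) (use less assms(2) that in \<open>auto intro!: VP_commute VP_gen_closed\<close>)
    have swap_down: "?g (Suc ?q) ?p \<otimes>\<^bsub>?G\<^esub> (?g (Suc (Suc ?q)) (Suc ?p) \<otimes>\<^bsub>?G\<^esub> z)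
        = ?g (Suc (Suc ?q)) (Suc ?p) \<otimes>\<^bsub>?G\<^esub> (?g (Suc ?q) ?p \<otimes>\<^bsub>?G\<^esub> z)"
      if "z \<in> carrier ?G" for z
      by (rule N.commutes_left) (use less assms(2) that in \<open>auto intro!: VP_commute VP_gen_closed\<close>)
    consider "a = ?p" "b = ?q" | "a = ?q" "b = ?p"
      | "a = ?p" "b \<noteq> ?p" "b \<noteq> ?q" | "a = ?q" "b \<noteq> ?p" "b \<noteq> ?q"
      | "b = ?p" "a \<noteq> ?p" "a \<noteq> ?q" | "b = ?q" "a \<noteq> ?p" "a \<noteq> ?q"
      | "a \<noteq> ?p" "b \<noteq> ?p" "a \<noteq> ?q" "b \<noteq> ?q"
      using ab(3) by blast
    then show ?thesis
      using less assms(2) ab p q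
      by cases (simp_all add: rules strand_unshift_unshift_less swap_up swap_down
          del: One_nat_def atLeastAtMost_iff)
  qed
qed (use assms in auto)

lemma simplicial_group_VAP: "simplicial_group VAP VAP_face VAP_degen"
proof -
  have VAP: "VAP n = VP (Suc n)" for n
    by (simp add: VAP_def)
  show ?thesis
    by (rule simplicial_group.intro; unfold VAP)
      (rule group_VP VAP_face_hom VAP_degen_hom VAP_face_face VAP_degen_degen VAP_face_degen_less
        VAP_face_degen_same VAP_face_degen_greater; simp)+
qed

section \<open>Contraction by an extra degeneracy\<close>

lemma (in group) trivial_group_Mod_carrier: "trivial_group (G Mod carrier G)"
proof -
  have "carrier (G Mod carrier G) = {carrier G}"
    using subgroup_self one_closed by (auto simp: FactGroup_def RCOSETS_def coset_join2)
  then show ?thesis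
    unfolding trivial_group_def
    using normal.factorgroup_is_group[OF normal_self] by (simp add: FactGroup_def)
qed

lemma (in simplicial_group) face_group_hom:
  "i \<le> Suc n \<Longrightarrow> group_hom (G (Suc n)) (G n) (d (Suc n) i)"
  by (simp add: group_hom_def group_hom_axioms_def group face_hom)

lemma (in simplicial_group) moore_cycles_subgroup: "subgroup (moore_cycles G d n) (G n)"
proof (cases n)
  case 0
  then show ?thesis
    by (simp add: moore_cycles_def group group.subgroup_self)
next
  case (Suc m)
  have "subgroup (\<Inter>i\<in>{0..n}. kernel (G n) (G m) (d n i)) (G n)"
    using Suc by (intro group.subgroups_Inter[OF group]) (auto intro: group_hom.subgroup_kernel[OF face_group_hom])
  then show ?thesis
    using Suc by (simp add: moore_cycles_def)
qed

lemma (in simplicial_group) moore_boundaries_subset: "moore_boundaries G d n \<subseteq> moore_cycles G d n"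
proof
  fix y
  assume "y \<in> moore_boundaries G d n"
  then obtain x where y: "y = d (Suc n) 0 x"
    and x: "\<And>i. 1 \<le> i \<Longrightarrow> i \<le> Suc n \<Longrightarrow> x \<in> kernel (G (Suc n)) (G n) (d (Suc n) i)"
    by (auto simp: moore_boundaries_def)
  have xc: "x \<in> carrier (G (Suc n))"
    using x[of 1] by (simp add: kernel_def)
  then have yc: "y \<in> carrier (G n)"
    using group_hom.hom_closed[OF face_group_hom[of 0 n]] by (simp add: y)
  show "y \<in> moore_cycles G d n"
  proof (cases n)
    case 0
    then show ?thesis using yc by (simp add: moore_cycles_def)
  next
    case (Suc m)
    have "d (Suc m) i y = \<one>\<^bsub>G m\<^esub>" if "i \<le> Suc m" for i
    proof -
      have "d (Suc m) i y = d (Suc m) 0 (d (Suc (Suc m)) (Suc i) x)"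
        using face_face[of 0 "Suc i" m x] that xc by (simp add: y Suc)
      also have "d (Suc (Suc m)) (Suc i) x = \<one>\<^bsub>G (Suc m)\<^esub>"
        using x[of "Suc i"] that by (simp add: kernel_def Suc)
      finally show ?thesis
        using group_hom.hom_one[OF face_group_hom[of 0 m]] by simp
    qed
    then show ?thesis
      using yc by (auto simp: moore_cycles_def kernel_def Suc)
  qed
qed

theorem (in simplicial_group) contractible_if_extra_degeneracy:
  assumes extra: "\<And>n. h n \<in> hom (G n) (G (Suc n))"
    and face_zero: "\<And>n x. x \<in> carrier (G n) \<Longrightarrow> d (Suc n) 0 (h n x) = x"
    and face_Suc: "\<And>n i x. i \<le> Suc n \<Longrightarrow> x \<in> carrier (G (Suc n)) \<Longrightarrow>
      d (Suc (Suc n)) (Suc i) (h (Suc n) x) = h n (d (Suc n) i x)"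
    and trivial: "carrier (G 0) = {\<one>\<^bsub>G 0\<^esub>}"
  shows "contractible_simplicial_group G d s"
proof -
  have "moore_cycles G d n \<subseteq> moore_boundaries G d n" for n
  proof
    fix z
    assume z: "z \<in> moore_cycles G d n"
    then have zc: "z \<in> carrier (G n)"
      using subgroup.subset[OF moore_cycles_subgroup] by blast
    have "d (Suc n) (Suc i) (h n z) = \<one>\<^bsub>G n\<^esub>" if "i \<le> n" for i
    proof (cases n)
      \<comment> \<open>Here \<open>z\<close> has no face that could be moved through \<open>h\<close>; the target is trivial instead.\<close>
      case 0
      have "h n z \<in> carrier (G (Suc n))"
        using extra zc by (rule hom_in_carrier)
      then have "d (Suc n) (Suc i) (h n z) \<in> carrier (G n)"
        using that by (intro hom_in_carrier[OF face_hom]) auto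
      then show ?thesis using trivial 0 by simp
    next
      case (Suc m)
      have "d (Suc m) i z = \<one>\<^bsub>G m\<^esub>"
        using z that by (auto simp: moore_cycles_def kernel_def Suc)
      then show ?thesis
        using face_Suc[of i m z] that zc hom_one[OF extra group group] by (simp add: Suc)
    qed
    then have "d (n + 1) i (h n z) = \<one>\<^bsub>G n\<^esub>" if "i \<in> {1..n + 1}" for i
      using that by (cases i) auto
    then have "h n z \<in> (\<Inter>i\<in>{1..n + 1}. kernel (G (n + 1)) (G n) (d (n + 1) i))"
      using hom_in_carrier[OF extra zc] by (simp add: kernel_def)
    moreover have "z = d (n + 1) 0 (h n z)"
      using face_zero[OF zc] by simp
    ultimately show "z \<in> moore_boundaries G d n"
      unfolding moore_boundaries_def by (rule rev_image_eqI)
  qed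
  then have "moore_boundaries G d n = moore_cycles G d n" for n
    using moore_boundaries_subset by blast
  moreover have "group ((G n)\<lparr>carrier := moore_cycles G d n\<rparr>)" for n
    using subgroup.subgroup_is_group[OF moore_cycles_subgroup group] .
  ultimately have "trivial_group (moore_homotopy_group G d n)" for n
    using group.trivial_group_Mod_carrier[of "(G n)\<lparr>carrier := moore_cycles G d n\<rparr>"]
    by (simp add: moore_homotopy_group_def)
  then show ?thesis
    by (simp add: contractible_simplicial_group_def simplicial_group_axioms)
qed

definition add_first_strand :: "nat \<Rightarrow> (nat \<times> nat) gword set \<Rightarrow> (nat \<times> nat) gword set" where
  "add_first_strand n = presented_hom (VP (Suc n)) (\<lambda>(k, l). VP_gen (Suc n) (Suc k) (Suc l))"

lemma add_first_strand_hom: "add_first_strand n \<in> hom (VP n) (VP (Suc n))"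
  unfolding add_first_strand_def
  by (rule VP_hom_exists(1)[OF group_VP]; unfold case_prod_conv;
      intro VP_gen_closed VP_commute VP_triangle; auto)

lemma add_first_strand_gen:
  assumes "k \<in> {1..n}" "l \<in> {1..n}" "k \<noteq> l"
  shows "add_first_strand n (VP_gen n k l) = VP_gen (Suc n) (Suc k) (Suc l)"
proof -
  have "add_first_strand n (VP_gen n k l) = (\<lambda>(k, l). VP_gen (Suc n) (Suc k) (Suc l)) (k, l)"
    unfolding add_first_strand_def
    by (rule VP_hom_exists(2)[OF group_VP _ _ _ assms]; unfold case_prod_conv;
        intro VP_gen_closed VP_commute VP_triangle; auto)
  then show ?thesis by simp
qed

lemma VAP_face_zero_add_first_strand:
  assumes "x \<in> carrier (VP (Suc n))"
  shows "VAP_face (Suc n) 0 (add_first_strand (Suc n) x) = x"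
proof -
  have "VAP_face (Suc n) 0 (add_first_strand (Suc n) x) = id (id x)"
    by (rule VP_comp_eqI[OF add_first_strand_hom VAP_face_hom VP_id_hom VP_id_hom assms])
      (auto simp: add_first_strand_gen VAP_face_gen strand_shift_def)
  then show ?thesis by simp
qed

lemma VAP_face_Suc_add_first_strand:
  assumes "i \<le> Suc n" "x \<in> carrier (VP (Suc (Suc n)))"
  shows "VAP_face (Suc (Suc n)) (Suc i) (add_first_strand (Suc (Suc n)) x)
    = add_first_strand (Suc n) (VAP_face (Suc n) i x)"
proof (rule VP_comp_eqI[OF add_first_strand_hom VAP_face_hom VAP_face_hom add_first_strand_hom assms(2)])
  fix a b
  assume ab: "a \<in> {1..Suc (Suc n)}" "b \<in> {1..Suc (Suc n)}" "a \<noteq> b"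
  have shift: "strand_shift (Suc (Suc i)) (Suc k) = Suc (strand_shift (Suc i) k)" if "k \<noteq> 0" for k
    using that by (auto simp: strand_shift_def)
  have "Suc a \<in> {1..Suc (Suc (Suc n))}" "Suc b \<in> {1..Suc (Suc (Suc n))}" "a \<noteq> 0" "b \<noteq> 0"
      "Suc i \<in> {1..Suc (Suc n)}"
    using ab assms(1) by auto
  then show "VAP_face (Suc (Suc n)) (Suc i) (add_first_strand (Suc (Suc n)) (VP_gen (Suc (Suc n)) a b))
      = add_first_strand (Suc n) (VAP_face (Suc n) i (VP_gen (Suc (Suc n)) a b))"
    using ab assms(1) hom_one[OF add_first_strand_hom group_VP group_VP]
    by (simp add: add_first_strand_gen VAP_face_gen shift strand_shift_inj strand_shift_range
        del: One_nat_def atLeastAtMost_iff)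
qed (use assms in auto)

theorem mainTheorem3:
  shows "contractible_simplicial_group VAP VAP_face VAP_degen"
proof -
  interpret simplicial_group VAP VAP_face VAP_degen
    by (rule simplicial_group_VAP)
  show ?thesis
  proof (rule contractible_if_extra_degeneracy)
    show "add_first_strand (Suc n) \<in> hom (VAP n) (VAP (Suc n))" for n
      using add_first_strand_hom[of "Suc n"] by (simp add: VAP_def)
    show "VAP_face (Suc n) 0 (add_first_strand (Suc n) x) = x" if "x \<in> carrier (VAP n)" for n x
      using that by (intro VAP_face_zero_add_first_strand) (simp add: VAP_def)
    show "VAP_face (Suc (Suc n)) (Suc i) (add_first_strand (Suc (Suc n)) x)
        = add_first_strand (Suc n) (VAP_face (Suc n) i x)"
      if "i \<le> Suc n" "x \<in> carrier (VAP (Suc n))" for n i x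
      using that by (intro VAP_face_Suc_add_first_strand) (simp_all add: VAP_def)
    show "carrier (VAP 0) = {\<one>\<^bsub>VAP 0\<^esub>}"
      using carrier_VP_1 by (simp add: VAP_def)
  qed
qed

end
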